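(* Let $c$ be a well-formed GCL command and $f$ a label with $\mathsf{okf}(c,f)$, and let $P,Q$ be sets of stores. Suppose $an$ is a valid annotation of the automaton $\mathsf{aut}(c,f)$ for the specification $\{P\}\{Q\}$. Then the judgment $c:\{P\}\{Q\}$ is derivable in the proof system HL+, by a derivation whose assertions are built from the assertions $an(i)$ using boolean combinations with boolean expressions occurring in $c$ and with equality tests $pc=n$ of a fresh variable $pc$ against numeric literals, together with substitution instances $an(i)[x:=e]$ for assignments $x:=e$ occurring in $c$.
   Context: Stores are total maps from integer variables to $\mathbb{Z}$. GCL commands: $c ::= \mathsf{skip}^n \mid x :=^n e \mid c;c \mid \mathsf{if}^n\, gcs\,\mathsf{fi} \mid \mathsf{do}^n\, gcs\,\mathsf{od}$, $gcs ::= e\to c \mid e\to c \,\square\, gcs$ (nonempty), $n\in\mathbb{Z}$ labels, expressions always defined, boolean expressions built from primitive ones with $\wedge,\vee,\neg$; $\mathsf{enab}(gcs)$ is the disjunction of the guards. Well formed: well typed, and every $\mathsf{if}^n gcs\,\mathsf{fi}$ subcommand has $\mathsf{enab}(gcs)$ true in all stores. Denotation $[\![c]\!]$: standard big-step partial-correctness relation (identity for skip; update for assignment; composition; if chooses any enabled branch; do iterates enabled branches until $\mathsf{enab}(gcs)$ is false). $\mathsf{lab}(c)$ is the label of $c$ ($\mathsf{lab}(c;d)=\mathsf{lab}(c)$), $\mathsf{labs}(c)$ its set of labels, $\mathsf{okf}(c,f)$: labels in $c$ positive and pairwise distinct and $f\notin\mathsf{labs}(c)$; $\mathsf{sub}(n,c)$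 is the subcommand labelled $n$. Following successor $\mathsf{fsuc}$: $\mathsf{fsuc}(n,\mathsf{skip}^n,f)=\mathsf{fsuc}(n,x:=^ne,f)=\mathsf{fsuc}(n,\mathsf{if}^n\ldots,f)=\mathsf{fsuc}(n,\mathsf{do}^n\ldots,f)=f$; $\mathsf{fsuc}(n,c;d,f)=\mathsf{fsuc}(n,c,\mathsf{lab}(d))$ if $n\in\mathsf{labs}(c)$, else $\mathsf{fsuc}(n,d,f)$; for $m\in\mathsf{labs}(d)$, $e\to d$ in $gcs$: $\mathsf{fsuc}(m,\mathsf{if}^n gcs\,\mathsf{fi},f)=\mathsf{fsuc}(m,d,f)$, $\mathsf{fsuc}(m,\mathsf{do}^n gcs\,\mathsf{od},f)=\mathsf{fsuc}(m,d,n)$. Small steps: $\langle\mathsf{if}^n gcs\,\mathsf{fi},s\rangle\to\langle d,s\rangle$ and $\langle\mathsf{do}^n gcs\,\mathsf{od},s\rangle\to\langle d;\mathsf{do}^n gcs\,\mathsf{od},s\rangle$ for $e\to d\in gcs$ with $e$ true at $s$; $\langle\mathsf{do}^n gcs\,\mathsf{od},s\rangle\to\langle\mathsf{skip}^{-n},s\rangle$ if $\mathsf{enab}(gcs)$ false; $\langle x:=^ne,s\rangle\to\langle\mathsf{skip}^{-n},s[x\mapsto[\![e]\!](s)]\rangle$; $\langle\mathsf{skip}^n;c,s\rangle\to\langle c,s\rangle$; $\langle c;b,s\rangle\to\langle d;b,t\rangle$ if $\langle c,s\rangle\to\langle d,t\rangle$. The automaton $\mathsf{aut}(c,f)$ has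 control points $\mathsf{labs}(c)\cup\{f\}$, stores as data, initial point $\mathsf{lab}(c)$, final point $f$, and $(n,s)\Rightarrow(m,t)$ iff $\langle\mathsf{sub}(n,c),s\rangle\to\langle d,t\rangle$ with ($\mathsf{lab}(d)>0$ and $m=\mathsf{lab}(d)$) or ($\mathsf{lab}(d)<0$ and $m=\mathsf{fsuc}(n,c,f)$), or $\mathsf{sub}(n,c)=\mathsf{skip}^n$, $m=\mathsf{fsuc}(n,c,f)$, $t=s$. An annotation for $\{P\}\{Q\}$ maps control points to sets of stores with $an(\mathsf{lab}(c))=P$, $an(f)=Q$; it is valid if $s\in an(n)$ and $(n,s)\Rightarrow(m,t)$ imply $t\in an(m)$. Assertions are sets of stores; a boolean expression $e$ denotes $\{s:[\![e]\!](s)=\mathrm{true}\}$; $s\in P[x:=e]$ iff $s[x\mapsto[\![e]\!](s)]\in P$; $\mathrm{indep}(x,P)$ means membership in $P$ does not depend on $x$; $\mathsf{ghost}(x,c)$: $x$ occurs in $c$ only in assignments to $x$; $\mathsf{erase}(x,c)$ replaces each assignment to $x$ by skip. HL+ rules: Rewrite (from $c:\{P\}\{Q\}$ and $c\cong d$ infer $d:\{P\}\{Q\}$); Ghost (from $c:\{P\}\{Q\}$, $\mathsf{ghost}(x,c)$, $\mathrm{indep}(x,P)$, $\mathrm{indep}(x,Q)$ infer $\mathsf{erase}(x,c):\{P\}\{Q\}$); Do (from $c:\{e\wedge P\}\{P\}$ for all $e\to c\in gcs$ infer $\mathsf{do}\,gcs\,\mathsf{od}:\{P\}\{P\wedge\neg\mathsf{enab}(gcs)\}$);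 Asgn ($x:=e:\{P[x:=e]\}\{P\}$); Skip ($\mathsf{skip}:\{P\}\{P\}$); Seq; If (from $c:\{e\wedge P\}\{Q\}$ for all $e\to c\in gcs$ infer $\mathsf{if}\,gcs\,\mathsf{fi}:\{P\}\{Q\}$); Conseq (with entailment as set inclusion); False ($c:\{\mathrm{false}\}\{P\}$). Here $c\cong d$ means $\mathrm{Hyp}\vdash\mathcal{K}(c)=\mathcal{K}(d)$ in Kleene algebra with tests, with $\mathcal{K}$ the standard translation ($\mathcal{K}(\mathsf{skip})=1$, $;\mapsto;$, $\mathcal{K}(\mathsf{if}\,gcs\,\mathsf{fi})=\sum_{e\to c\in gcs}\mathcal{K}(e);\mathcal{K}(c)$, $\mathcal{K}(\mathsf{do}\,gcs\,\mathsf{od})=(\sum_{e\to c\in gcs}\mathcal{K}(e);\mathcal{K}(c))^*;\neg\mathcal{K}(\mathsf{enab}(gcs))$, boolean connectives to test operations, primitive tests and assignments to atoms) and $\mathrm{Hyp}$ the equations $\mathcal{K}(e)=0$ for every unsatisfiable boolean $e$ and $\mathcal{K}(e_0);\mathcal{K}(x:=e);\neg\mathcal{K}(e_1)=0$ whenever $e_0\Rightarrow e_1[x:=e]$ is valid. *)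

theory Defs
  imports Main
begin

section \<open>Expressions\<close>

type_synonym vname = string
type_synonym store = "vname \<Rightarrow> int"
type_synonym assertion = "store set"

text \<open>The expression language is left open: it is given by arbitrary types 'f of operator
  symbols and 'p of predicate symbols together with a (total) interpretation. Integer and boolean
  expressions are different types, so every command is well typed. Literals, variables and equality
  are always present.\<close>

record ('f, 'p) interp =
  opsem :: "'f \<Rightarrow> int list \<Rightarrow> int"
  prsem :: "'p \<Rightarrow> int list \<Rightarrow> bool"

datatype 'f iexp = Lit int | Var vname | Op 'f "'f iexp list"

datatype ('f, 'p) bprim = Eq "'f iexp" "'f iexp" | Pred 'p "'f iexp list"

datatype ('f, 'p) bexp =
    Prim "('f, 'p) bprim"
  | BAnd "('f, 'p) bexp" "('f, 'p) bexp"
  | BOr "('f, 'p) bexp" "('f, 'p) bexp"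
  | BNot "('f, 'p) bexp"

fun ival :: "('f, 'p) interp \<Rightarrow> 'f iexp \<Rightarrow> store \<Rightarrow> int" where
  "ival I (Lit n) s = n"
| "ival I (Var x) s = s x"
| "ival I (Op g as) s = opsem I g (map (\<lambda>a. ival I a s) as)"

fun pval :: "('f, 'p) interp \<Rightarrow> ('f, 'p) bprim \<Rightarrow> store \<Rightarrow> bool" where
  "pval I (Eq a b) s = (ival I a s = ival I b s)"
| "pval I (Pred p as) s = prsem I p (map (\<lambda>a. ival I a s) as)"

fun bval :: "('f, 'p) interp \<Rightarrow> ('f, 'p) bexp \<Rightarrow> store \<Rightarrow> bool" where
  "bval I (Prim p) s = pval I p s"
| "bval I (BAnd e e') s = (bval I e s \<and> bval I e' s)"
| "bval I (BOr e e') s = (bval I e s \<or> bval I e' s)"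
| "bval I (BNot e) s = (\<not> bval I e s)"

fun ivars :: "'f iexp \<Rightarrow> vname set" where
  "ivars (Lit n) = {}"
| "ivars (Var x) = {x}"
| "ivars (Op g as) = (\<Union>a\<in>set as. ivars a)"

fun pvars :: "('f, 'p) bprim \<Rightarrow> vname set" where
  "pvars (Eq a b) = ivars a \<union> ivars b"
| "pvars (Pred p as) = (\<Union>a\<in>set as. ivars a)"

fun bvars :: "('f, 'p) bexp \<Rightarrow> vname set" where
  "bvars (Prim p) = pvars p"
| "bvars (BAnd e e') = bvars e \<union> bvars e'"
| "bvars (BOr e e') = bvars e \<union> bvars e'"
| "bvars (BNot e) = bvars e"

fun bsubs :: "('f, 'p) bexp \<Rightarrow> ('f, 'p) bexp set" where
  "bsubs (Prim p) = {Prim p}"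
| "bsubs (BAnd e e') = {BAnd e e'} \<union> bsubs e \<union> bsubs e'"
| "bsubs (BOr e e') = {BOr e e'} \<union> bsubs e \<union> bsubs e'"
| "bsubs (BNot e) = {BNot e} \<union> bsubs e"


section \<open>Assertions\<close>

definition bsem :: "('f, 'p) interp \<Rightarrow> ('f, 'p) bexp \<Rightarrow> assertion" where
  "bsem I e = {s. bval I e s}"

text \<open>\<open>asubst I x e P\<close> is P[x:=e].\<close>

definition asubst :: "('f, 'p) interp \<Rightarrow> vname \<Rightarrow> 'f iexp \<Rightarrow> assertion \<Rightarrow> assertion" where
  "asubst I x e P = {s. s(x := ival I e s) \<in> P}"

definition indep :: "vname \<Rightarrow> assertion \<Rightarrow> bool" where
  "indep x P \<longleftrightarrow> (\<forall>s v. s(x := v) \<in> P \<longleftrightarrow> s \<in> P)"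


section \<open>Labelled guarded commands\<close>

datatype ('f, 'p) com =
    Skip int
  | Assign int vname "'f iexp"
  | Seq "('f, 'p) com" "('f, 'p) com"
  | IfFi int "('f, 'p) gcs"
  | DoOd int "('f, 'p) gcs"
and ('f, 'p) gcs =
    GC "('f, 'p) bexp" "('f, 'p) com"
  | GCs "('f, 'p) bexp" "('f, 'p) com" "('f, 'p) gcs"

primrec alts :: "('f, 'p) gcs \<Rightarrow> (('f, 'p) bexp \<times> ('f, 'p) com) set" where
  "alts (GC e c) = {(e, c)}"
| "alts (GCs e c g) = insert (e, c) (alts g)"

primrec enab :: "('f, 'p) gcs \<Rightarrow> ('f, 'p) bexp" where
  "enab (GC e c) = e"
| "enab (GCs e c g) = BOr e (enab g)"

primrec wellformed :: "('f, 'p) interp \<Rightarrow> ('f, 'p) com \<Rightarrow> bool"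
  and wellformed_gcs :: "('f, 'p) interp \<Rightarrow> ('f, 'p) gcs \<Rightarrow> bool" where
  "wellformed I (Skip n) = True"
| "wellformed I (Assign n x e) = True"
| "wellformed I (Seq c d) = (wellformed I c \<and> wellformed I d)"
| "wellformed I (IfFi n g) = ((\<forall>s. bval I (enab g) s) \<and> wellformed_gcs I g)"
| "wellformed I (DoOd n g) = wellformed_gcs I g"
| "wellformed_gcs I (GC e c) = wellformed I c"
| "wellformed_gcs I (GCs e c g) = (wellformed I c \<and> wellformed_gcs I g)"

primrec lab :: "('f, 'p) com \<Rightarrow> int" where
  "lab (Skip n) = n"
| "lab (Assign n x e) = n"
| "lab (Seq c d) = lab c"
| "lab (IfFi n g) = n"
| "lab (DoOd n g) = n"

primrec lablist :: "('f, 'p) com \<Rightarrow> int list"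
  and lablist_gcs :: "('f, 'p) gcs \<Rightarrow> int list" where
  "lablist (Skip n) = [n]"
| "lablist (Assign n x e) = [n]"
| "lablist (Seq c d) = lablist c @ lablist d"
| "lablist (IfFi n g) = n # lablist_gcs g"
| "lablist (DoOd n g) = n # lablist_gcs g"
| "lablist_gcs (GC e c) = lablist c"
| "lablist_gcs (GCs e c g) = lablist c @ lablist_gcs g"

definition labs :: "('f, 'p) com \<Rightarrow> int set" where
  "labs c = set (lablist c)"

definition okf :: "('f, 'p) com \<Rightarrow> int \<Rightarrow> bool" where
  "okf c f \<longleftrightarrow> (\<forall>n\<in>labs c. 0 < n) \<and> distinct (lablist c) \<and> f \<notin> labs c"

text \<open>\<open>sub n c\<close> is never a sequence: the label of a sequence belongs to its first component that
  is not a sequence.\<close>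

primrec sub :: "int \<Rightarrow> ('f, 'p) com \<Rightarrow> ('f, 'p) com option"
  and sub_gcs :: "int \<Rightarrow> ('f, 'p) gcs \<Rightarrow> ('f, 'p) com option" where
  "sub n (Skip l) = (if n = l then Some (Skip l) else None)"
| "sub n (Assign l x e) = (if n = l then Some (Assign l x e) else None)"
| "sub n (Seq c d) = (if n \<in> labs c then sub n c else sub n d)"
| "sub n (IfFi l g) = (if n = l then Some (IfFi l g) else sub_gcs n g)"
| "sub n (DoOd l g) = (if n = l then Some (DoOd l g) else sub_gcs n g)"
| "sub_gcs n (GC e c) = sub n c"
| "sub_gcs n (GCs e c g) = (if n \<in> labs c then sub n c else sub_gcs n g)"

text \<open>\<open>fsuc n c f\<close> is meaningful only for n in \<open>labs c\<close>.\<close>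

primrec fsuc :: "int \<Rightarrow> ('f, 'p) com \<Rightarrow> int \<Rightarrow> int"
  and fsuc_gcs :: "int \<Rightarrow> ('f, 'p) gcs \<Rightarrow> int \<Rightarrow> int" where
  "fsuc n (Skip l) f = f"
| "fsuc n (Assign l x e) f = f"
| "fsuc n (Seq c d) f = (if n \<in> labs c then fsuc n c (lab d) else fsuc n d f)"
| "fsuc n (IfFi l g) f = (if n = l then f else fsuc_gcs n g f)"
| "fsuc n (DoOd l g) f = (if n = l then f else fsuc_gcs n g l)"
| "fsuc_gcs n (GC e c) f = fsuc n c f"
| "fsuc_gcs n (GCs e c g) f = (if n \<in> labs c then fsuc n c f else fsuc_gcs n g f)"

primrec vars :: "('f, 'p) com \<Rightarrow> vname set"
  and vars_gcs :: "('f, 'p) gcs \<Rightarrow> vname set" where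
  "vars (Skip n) = {}"
| "vars (Assign n x e) = insert x (ivars e)"
| "vars (Seq c d) = vars c \<union> vars d"
| "vars (IfFi n g) = vars_gcs g"
| "vars (DoOd n g) = vars_gcs g"
| "vars_gcs (GC e c) = bvars e \<union> vars c"
| "vars_gcs (GCs e c g) = bvars e \<union> vars c \<union> vars_gcs g"

text \<open>The boolean expressions and the assignments occurring in a command.\<close>

primrec bexps :: "('f, 'p) com \<Rightarrow> ('f, 'p) bexp set"
  and bexps_gcs :: "('f, 'p) gcs \<Rightarrow> ('f, 'p) bexp set" where
  "bexps (Skip n) = {}"
| "bexps (Assign n x e) = {}"
| "bexps (Seq c d) = bexps c \<union> bexps d"
| "bexps (IfFi n g) = bexps_gcs g"
| "bexps (DoOd n g) = bexps_gcs g"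
| "bexps_gcs (GC e c) = bsubs e \<union> bexps c"
| "bexps_gcs (GCs e c g) = bsubs e \<union> bexps c \<union> bexps_gcs g"

primrec assigns :: "('f, 'p) com \<Rightarrow> (vname \<times> 'f iexp) set"
  and assigns_gcs :: "('f, 'p) gcs \<Rightarrow> (vname \<times> 'f iexp) set" where
  "assigns (Skip n) = {}"
| "assigns (Assign n x e) = {(x, e)}"
| "assigns (Seq c d) = assigns c \<union> assigns d"
| "assigns (IfFi n g) = assigns_gcs g"
| "assigns (DoOd n g) = assigns_gcs g"
| "assigns_gcs (GC e c) = assigns c"
| "assigns_gcs (GCs e c g) = assigns c \<union> assigns_gcs g"

text \<open>A ghost variable may occur on both sides of assignments to itself.\<close>

primrec ghost :: "vname \<Rightarrow> ('f, 'p) com \<Rightarrow> bool"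
  and ghost_gcs :: "vname \<Rightarrow> ('f, 'p) gcs \<Rightarrow> bool" where
  "ghost x (Skip n) = True"
| "ghost x (Assign n y e) = (x = y \<or> x \<notin> ivars e)"
| "ghost x (Seq c d) = (ghost x c \<and> ghost x d)"
| "ghost x (IfFi n g) = ghost_gcs x g"
| "ghost x (DoOd n g) = ghost_gcs x g"
| "ghost_gcs x (GC e c) = (x \<notin> bvars e \<and> ghost x c)"
| "ghost_gcs x (GCs e c g) = (x \<notin> bvars e \<and> ghost x c \<and> ghost_gcs x g)"

primrec erase :: "vname \<Rightarrow> ('f, 'p) com \<Rightarrow> ('f, 'p) com"
  and erase_gcs :: "vname \<Rightarrow> ('f, 'p) gcs \<Rightarrow> ('f, 'p) gcs" where
  "erase x (Skip n) = Skip n"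
| "erase x (Assign n y e) = (if x = y then Skip n else Assign n y e)"
| "erase x (Seq c d) = Seq (erase x c) (erase x d)"
| "erase x (IfFi n g) = IfFi n (erase_gcs x g)"
| "erase x (DoOd n g) = DoOd n (erase_gcs x g)"
| "erase_gcs x (GC e c) = GC e (erase x c)"
| "erase_gcs x (GCs e c g) = GCs e (erase x c) (erase_gcs x g)"


section \<open>Small steps, automata and annotations\<close>

inductive step :: "('f, 'p) interp \<Rightarrow> ('f, 'p) com \<times> store \<Rightarrow> ('f, 'p) com \<times> store \<Rightarrow> bool"
  for I where
  "\<lbrakk>(e, d) \<in> alts g; bval I e s\<rbrakk> \<Longrightarrow> step I (IfFi n g, s) (d, s)"
| "\<lbrakk>(e, d) \<in> alts g; bval I e s\<rbrakk> \<Longrightarrow> step I (DoOd n g, s) (Seq d (DoOd n g), s)"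
| "\<not> bval I (enab g) s \<Longrightarrow> step I (DoOd n g, s) (Skip (- n), s)"
| "step I (Assign n x e, s) (Skip (- n), s(x := ival I e s))"
| "step I (Seq (Skip n) c, s) (c, s)"
| "step I (c, s) (d, t) \<Longrightarrow> step I (Seq c b, s) (Seq d b, t)"

record 'd automaton =
  ctrl :: "int set"
  init :: int
  fin :: int
  trans :: "int \<times> 'd \<Rightarrow> int \<times> 'd \<Rightarrow> bool"

definition aut :: "('f, 'p) interp \<Rightarrow> ('f, 'p) com \<Rightarrow> int \<Rightarrow> store automaton" where
  "aut I c f = \<lparr>
     ctrl = labs c \<union> {f},
     init = lab c,
     fin = f,
     trans = (\<lambda>(n, s) (m, t). \<exists>b. sub n c = Some b \<and>
       ((\<exists>d. step I (b, s) (d, t) \<and>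
             (0 < lab d \<and> m = lab d \<or> lab d < 0 \<and> m = fsuc n c f)) \<or>
        (b = Skip n \<and> m = fsuc n c f \<and> t = s)))\<rparr>"

text \<open>Annotations are total functions, of which only the values at control points matter.\<close>

definition annotation_for :: "'d automaton \<Rightarrow> 'd set \<Rightarrow> 'd set \<Rightarrow> (int \<Rightarrow> 'd set) \<Rightarrow> bool" where
  "annotation_for A P Q an \<longleftrightarrow> an (init A) = P \<and> an (fin A) = Q"

definition valid_annotation :: "'d automaton \<Rightarrow> (int \<Rightarrow> 'd set) \<Rightarrow> bool" where
  "valid_annotation A an \<longleftrightarrow>
     (\<forall>n\<in>ctrl A. \<forall>m\<in>ctrl A. \<forall>s t. s \<in> an n \<and> trans A (n, s) (m, t) \<longrightarrow> t \<in> an m)"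


section \<open>Kleene algebra with tests\<close>

text \<open>Terms are two-sorted: Boolean tests are embedded by \<open>KTest\<close>. The constants 0 and 1 of the
  Kleene algebra are those of the test algebra, and on tests the operations + and ; of the two
  sorts are identified by the rules \<open>test_plus\<close> and \<open>test_seq\<close> below.\<close>

datatype 'b ktest = TAtom 'b | TZero | TOne | TPlus "'b ktest" "'b ktest" | TSeq "'b ktest" "'b ktest"
  | TNeg "'b ktest"

datatype ('b, 'a) kat = KTest "'b ktest" | KAtom 'a | KPlus "('b, 'a) kat" "('b, 'a) kat"
  | KSeq "('b, 'a) kat" "('b, 'a) kat" | KStar "('b, 'a) kat"

abbreviation KZero :: "('b, 'a) kat" where "KZero \<equiv> KTest TZero"
abbreviation KOne :: "('b, 'a) kat" where "KOne \<equiv> KTest TOne"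

text \<open>\<open>kat_eq H k l\<close>: the equation k = l is derivable from the hypotheses H and the axioms of
  Kleene algebra with tests; k \<open>\<le>\<close> l stands for k + l = l.\<close>

inductive kat_eq :: "(('b, 'a) kat \<times> ('b, 'a) kat) set \<Rightarrow> ('b, 'a) kat \<Rightarrow> ('b, 'a) kat \<Rightarrow> bool"
  for H where
  hyp: "(k, l) \<in> H \<Longrightarrow> kat_eq H k l"
| refl: "kat_eq H k k"
| sym: "kat_eq H k l \<Longrightarrow> kat_eq H l k"
| trans: "\<lbrakk>kat_eq H k l; kat_eq H l m\<rbrakk> \<Longrightarrow> kat_eq H k m"
| cong_plus: "\<lbrakk>kat_eq H k k'; kat_eq H l l'\<rbrakk> \<Longrightarrow> kat_eq H (KPlus k l) (KPlus k' l')"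
| cong_seq: "\<lbrakk>kat_eq H k k'; kat_eq H l l'\<rbrakk> \<Longrightarrow> kat_eq H (KSeq k l) (KSeq k' l')"
| cong_star: "kat_eq H k k' \<Longrightarrow> kat_eq H (KStar k) (KStar k')"
| cong_neg: "kat_eq H (KTest a) (KTest b) \<Longrightarrow> kat_eq H (KTest (TNeg a)) (KTest (TNeg b))"
| plus_assoc: "kat_eq H (KPlus (KPlus k l) m) (KPlus k (KPlus l m))"
| plus_comm: "kat_eq H (KPlus k l) (KPlus l k)"
| plus_zero: "kat_eq H (KPlus k KZero) k"
| plus_idem: "kat_eq H (KPlus k k) k"
| seq_assoc: "kat_eq H (KSeq (KSeq k l) m) (KSeq k (KSeq l m))"
| one_seq: "kat_eq H (KSeq KOne k) k"
| seq_one: "kat_eq H (KSeq k KOne) k"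
| zero_seq: "kat_eq H (KSeq KZero k) KZero"
| seq_zero: "kat_eq H (KSeq k KZero) KZero"
| distrib_left: "kat_eq H (KSeq k (KPlus l m)) (KPlus (KSeq k l) (KSeq k m))"
| distrib_right: "kat_eq H (KSeq (KPlus k l) m) (KPlus (KSeq k m) (KSeq l m))"
| star_unfold_left: "kat_eq H (KPlus (KPlus KOne (KSeq k (KStar k))) (KStar k)) (KStar k)"
| star_unfold_right: "kat_eq H (KPlus (KPlus KOne (KSeq (KStar k) k)) (KStar k)) (KStar k)"
| star_induct_left:
    "kat_eq H (KPlus (KPlus l (KSeq k m)) m) m \<Longrightarrow> kat_eq H (KPlus (KSeq (KStar k) l) m) m"
| star_induct_right:
    "kat_eq H (KPlus (KPlus l (KSeq m k)) m) m \<Longrightarrow> kat_eq H (KPlus (KSeq l (KStar k)) m) m"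
| test_plus: "kat_eq H (KTest (TPlus a b)) (KPlus (KTest a) (KTest b))"
| test_seq: "kat_eq H (KTest (TSeq a b)) (KSeq (KTest a) (KTest b))"
| test_comm: "kat_eq H (KTest (TSeq a b)) (KTest (TSeq b a))"
| test_distrib: "kat_eq H (KTest (TPlus a (TSeq b c))) (KTest (TSeq (TPlus a b) (TPlus a c)))"
| test_excluded_middle: "kat_eq H (KTest (TPlus a (TNeg a))) KOne"
| test_contradiction: "kat_eq H (KTest (TSeq a (TNeg a))) KZero"

type_synonym ('f, 'p) gkat = "(('f, 'p) bprim, vname \<times> 'f iexp) kat"

primrec trb :: "('f, 'p) bexp \<Rightarrow> ('f, 'p) bprim ktest" where
  "trb (Prim p) = TAtom p"
| "trb (BAnd e e') = TSeq (trb e) (trb e')"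
| "trb (BOr e e') = TPlus (trb e) (trb e')"
| "trb (BNot e) = TNeg (trb e)"

primrec trc :: "('f, 'p) com \<Rightarrow> ('f, 'p) gkat"
  and trc_gcs :: "('f, 'p) gcs \<Rightarrow> ('f, 'p) gkat" where
  "trc (Skip n) = KOne"
| "trc (Assign n x e) = KAtom (x, e)"
| "trc (Seq c d) = KSeq (trc c) (trc d)"
| "trc (IfFi n g) = trc_gcs g"
| "trc (DoOd n g) = KSeq (KStar (trc_gcs g)) (KTest (TNeg (trb (enab g))))"
| "trc_gcs (GC e c) = KSeq (KTest (trb e)) (trc c)"
| "trc_gcs (GCs e c g) = KPlus (KSeq (KTest (trb e)) (trc c)) (trc_gcs g)"

definition Hyp :: "('f, 'p) interp \<Rightarrow> (('f, 'p) gkat \<times> ('f, 'p) gkat) set" where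
  "Hyp I =
     {(KTest (trb e), KZero) | e. bsem I e = {}} \<union>
     {(KSeq (KSeq (KTest (trb e0)) (KAtom (x, e))) (KTest (TNeg (trb e1))), KZero) | e0 x e e1.
        bsem I e0 \<subseteq> asubst I x e (bsem I e1)}"

definition kat_equiv :: "('f, 'p) interp \<Rightarrow> ('f, 'p) com \<Rightarrow> ('f, 'p) com \<Rightarrow> bool" where
  "kat_equiv I c d \<longleftrightarrow> kat_eq (Hyp I) (trc c) (trc d)"


section \<open>The proof system\<close>

text \<open>\<open>HLplus I \<A> c P Q\<close>: the judgment c:{P}{Q} has a derivation all of whose judgments, including
  the conclusion, have pre- and postconditions in \<open>\<A>\<close>. Derivability without restriction on
  the assertions is \<open>HLplus I UNIV c P Q\<close>.\<close>

inductive HLplus ::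
  "('f, 'p) interp \<Rightarrow> assertion set \<Rightarrow> ('f, 'p) com \<Rightarrow> assertion \<Rightarrow> assertion \<Rightarrow> bool"
  for I \<A> where
  Skip: "P \<in> \<A> \<Longrightarrow> HLplus I \<A> (Skip n) P P"
| Asgn: "\<lbrakk>asubst I x e P \<in> \<A>; P \<in> \<A>\<rbrakk> \<Longrightarrow> HLplus I \<A> (Assign n x e) (asubst I x e P) P"
| Seq: "\<lbrakk>HLplus I \<A> c P R; HLplus I \<A> d R Q\<rbrakk> \<Longrightarrow> HLplus I \<A> (Seq c d) P Q"
| If: "\<lbrakk>\<And>e c. (e, c) \<in> alts g \<Longrightarrow> HLplus I \<A> c (bsem I e \<inter> P) Q; P \<in> \<A>; Q \<in> \<A>\<rbrakk>
    \<Longrightarrow> HLplus I \<A> (IfFi n g) P Q"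
| Do: "\<lbrakk>\<And>e c. (e, c) \<in> alts g \<Longrightarrow> HLplus I \<A> c (bsem I e \<inter> P) P;
      P \<in> \<A>; P \<inter> - bsem I (enab g) \<in> \<A>\<rbrakk>
    \<Longrightarrow> HLplus I \<A> (DoOd n g) P (P \<inter> - bsem I (enab g))"
| Conseq: "\<lbrakk>P \<subseteq> P'; HLplus I \<A> c P' Q'; Q' \<subseteq> Q; P \<in> \<A>; Q \<in> \<A>\<rbrakk> \<Longrightarrow> HLplus I \<A> c P Q"
| False: "\<lbrakk>{} \<in> \<A>; P \<in> \<A>\<rbrakk> \<Longrightarrow> HLplus I \<A> c {} P"
| Rewrite: "\<lbrakk>HLplus I \<A> c P Q; kat_equiv I c d\<rbrakk> \<Longrightarrow> HLplus I \<A> d P Q"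
| Ghost: "\<lbrakk>HLplus I \<A> c P Q; ghost x c; indep x P; indep x Q\<rbrakk> \<Longrightarrow> HLplus I \<A> (erase x c) P Q"

text \<open>The assertions obtained from an annotation, for use with a program counter variable
  \<open>pc\<close>.\<close>

inductive_set assertions_from ::
  "('f, 'p) interp \<Rightarrow> ('f, 'p) com \<Rightarrow> int \<Rightarrow> (int \<Rightarrow> assertion) \<Rightarrow> vname \<Rightarrow> assertion set"
  for I c f an pc where
  annot: "i \<in> ctrl (aut I c f) \<Longrightarrow> an i \<in> assertions_from I c f an pc"
| subst: "\<lbrakk>i \<in> ctrl (aut I c f); (x, e) \<in> assigns c\<rbrakk>
    \<Longrightarrow> asubst I x e (an i) \<in> assertions_from I c f an pc"
| bool: "e \<in> bexps c \<Longrightarrow> bsem I e \<in> assertions_from I c f an pc"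
| pc_test: "bsem I (Prim (Eq (Var pc) (Lit n))) \<in> assertions_from I c f an pc"
| conj: "\<lbrakk>R \<in> assertions_from I c f an pc; S \<in> assertions_from I c f an pc\<rbrakk>
    \<Longrightarrow> R \<inter> S \<in> assertions_from I c f an pc"
| disj: "\<lbrakk>R \<in> assertions_from I c f an pc; S \<in> assertions_from I c f an pc\<rbrakk>
    \<Longrightarrow> R \<union> S \<in> assertions_from I c f an pc"
| neg: "R \<in> assertions_from I c f an pc \<Longrightarrow> - R \<in> assertions_from I c f an pc"

end

(* Since the automaton follows the control structure of c, an annotation of it is a proof outline:
   an (lab b) is the precondition of a subcommand b, the annotation at the control point following b
   is its postcondition, and the annotation at the label of a loop is an invariant of the loop.
   Induction on the structure turns the outline into a derivation. It uses neither Rewrite nor Ghost,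
   so pc plays no role in it. *)
theory Submission
  imports Defs
begin

lemma lab_in_labs: "lab c \<in> labs c"
  by (induction c rule: com.induct[where ?P2.0 = "\<lambda>_. True"]) (auto simp: labs_def)

lemma labs_alts: "(e, d) \<in> alts g \<Longrightarrow> labs d \<subseteq> set (lablist_gcs g)"
  by (induction g rule: gcs.induct[where ?P1.0 = "\<lambda>_. True"]) (auto simp: labs_def)

lemma distinct_alts: "(e, d) \<in> alts g \<Longrightarrow> distinct (lablist_gcs g) \<Longrightarrow> distinct (lablist d)"
  by (induction g rule: gcs.induct[where ?P1.0 = "\<lambda>_. True"]) auto

lemma bexps_alts: "(e, d) \<in> alts g \<Longrightarrow> bexps d \<subseteq> bexps_gcs g"
  by (induction g rule: gcs.induct[where ?P1.0 = "\<lambda>_. True"]) auto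

lemma self_in_bsubs: "e \<in> bsubs e"
  by (cases e) auto

lemma guard_in_bexps: "(e, d) \<in> alts g \<Longrightarrow> e \<in> bexps_gcs g"
  by (induction g rule: gcs.induct[where ?P1.0 = "\<lambda>_. True"]) (auto simp: self_in_bsubs)

lemma assigns_alts: "(e, d) \<in> alts g \<Longrightarrow> assigns d \<subseteq> assigns_gcs g"
  by (induction g rule: gcs.induct[where ?P1.0 = "\<lambda>_. True"]) auto

text \<open>\<open>sub_gcs\<close> and \<open>fsuc_gcs\<close> search the alternatives from the
  first on. Distinctness of the labels keeps an earlier alternative from capturing a label of
  \<open>d\<close>.\<close>

lemma sub_fsuc_alts:
  "\<lbrakk>(e, d) \<in> alts g; distinct (lablist_gcs g); n \<in> labs d\<rbrakk>
    \<Longrightarrow> sub_gcs n g = sub n d \<and> fsuc_gcs n g f = fsuc n d f"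
proof (induction g rule: gcs.induct[where ?P1.0 = "\<lambda>_. True"])
  case (GCs e' c g)
  then show ?case using labs_alts[of e d g] by (auto simp: labs_def)
qed auto

lemma sub_None:
  fixes c :: "('f, 'p) com" and g :: "('f, 'p) gcs"
  shows "n \<notin> labs c \<Longrightarrow> sub n c = None"
  and "n \<notin> set (lablist_gcs g) \<Longrightarrow> sub_gcs n g = None"
  by (induction c and g) (auto simp: labs_def)

text \<open>\<open>valid_annotation\<close> constrains only transitions whose target is a control
  point. This supplies that side condition for targets given by \<open>fsuc\<close>.\<close>

lemma fsuc_in_ctrl:
  fixes c :: "('f, 'p) com" and g :: "('f, 'p) gcs"
  shows "n \<in> labs c \<Longrightarrow> fsuc n c f \<in> labs c \<union> {f}"
  and "n \<in> set (lablist_gcs g) \<Longrightarrow> fsuc_gcs n g f \<in> set (lablist_gcs g) \<union> {f}"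
proof (induction c and g arbitrary: f and f)
  case (Seq c d)
  then show ?case using lab_in_labs[of d] by (fastforce simp: labs_def)
next
  case (DoOd l g)
  then show ?case using DoOd.IH[of l] by (auto simp: labs_def)
next
  case (IfFi l g)
  then show ?case using IfFi.IH[of f] by (auto simp: labs_def)
next
  case (GC e c)
  then show ?case using GC.IH[of f] by (auto simp: labs_def)
next
  case (GCs e c g)
  then show ?case using GCs.IH(1)[of f] GCs.IH(2)[of f] by (auto simp: labs_def)
qed (auto simp: labs_def)

text \<open>The automaton of \<open>d\<close> with exit \<open>h\<close> is a part of the automaton
  of \<open>c\<close>: it has fewer control points, and each of its transitions is also one of
  \<open>c\<close>, because \<open>sub\<close> and \<open>fsuc\<close> agree on the labels of
  \<open>d\<close>. Validity passes to such a part.\<close>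

lemma valid_annotation_subcommand:
  assumes "valid_annotation (aut I c f) an"
    and "\<And>n. n \<in> labs d \<Longrightarrow> sub n c = sub n d \<and> fsuc n c f = fsuc n d h"
    and "labs d \<union> {h} \<subseteq> labs c \<union> {f}" and "h \<notin> labs d"
  shows "valid_annotation (aut I d h) an"
proof -
  have "trans (aut I c f) (n, s) (m, t)" if "trans (aut I d h) (n, s) (m, t)" for n m s t
  proof -
    \<comment> \<open>A transition can leave only a label of \<open>d\<close>, so the agreement
      assumption covers its source.\<close>
    from that have "sub n d \<noteq> None"
      by (auto simp: aut_def)
    then have "n \<in> labs d"
      using sub_None(1) by metis
    with that assms(2)[of n] show ?thesis
      by (simp add: aut_def)
  qed
  moreover have "ctrl (aut I d h) \<subseteq> ctrl (aut I c f)"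
    using assms(3) by (simp add: aut_def)
  ultimately show ?thesis
    using assms(1) unfolding valid_annotation_def by blast
qed

text \<open>The disjunction \<open>enab g\<close> need not itself be a member of
  \<open>bexps c\<close>; it is assembled from the guards by closure under union.\<close>

lemma enab_in_assertions_from:
  "bexps_gcs g \<subseteq> bexps c \<Longrightarrow> bsem I (enab g) \<in> assertions_from I c f an pc"
proof (induction g rule: gcs.induct[where ?P1.0 = "\<lambda>_. True"])
  case (GC e d)
  then show ?case using self_in_bsubs[of e] by (auto intro: assertions_from.bool)
next
  case (GCs e d g)
  have "bsem I (enab (GCs e d g)) = bsem I e \<union> bsem I (enab g)"
    by (auto simp: bsem_def)
  with GCs show ?case
    using self_in_bsubs[of e] by (auto intro!: assertions_from.disj assertions_from.bool)
qed auto

text \<open>The sign of the label of the residual command decides where control goes: a positive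
  label is itself the next control point, a negative one marks termination of \<open>b\<close>, and
  control moves on to the following successor.\<close>

lemma annotation_step:
  assumes "valid_annotation (aut I c f) an" and "n \<in> labs c" and "sub n c = Some b"
    and "s \<in> an n" and "step I (b, s) (d, t)"
  shows "lab d \<in> labs c \<Longrightarrow> 0 < lab d \<Longrightarrow> t \<in> an (lab d)"
    and "lab d < 0 \<Longrightarrow> t \<in> an (fsuc n c f)"
proof -
  note * = assms(1)[unfolded valid_annotation_def, rule_format, of n _ s t]
  show "t \<in> an (lab d)" if "lab d \<in> labs c" "0 < lab d"
    using *[of "lab d"] assms(2-) that by (auto simp: aut_def)
  show "t \<in> an (fsuc n c f)" if "lab d < 0"
    using *[of "fsuc n c f"] assms(2-) that fsuc_in_ctrl(1)[of n c f] by (auto simp: aut_def)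
qed

lemma annotation_branch:
  assumes "valid_annotation (aut I b f) an" and "okf b f" and "b = IfFi n g \<or> b = DoOd n g"
    and "(e, d) \<in> alts g"
  shows "bsem I e \<inter> an n \<subseteq> an (lab d)"
proof
  fix s assume s: "s \<in> bsem I e \<inter> an n"
  \<comment> \<open>The witness is \<open>d\<close> for a conditional and
    \<open>Seq d (DoOd n g)\<close> for a loop; the label of a sequence is that of its first
    component.\<close>
  have "\<exists>d'. step I (b, s) (d', s) \<and> lab d' = lab d"
    using assms(3,4) s step.intros(1,2)[OF assms(4), of I s n] by (auto simp: bsem_def)
  then obtain d' where d': "step I (b, s) (d', s)" "lab d' = lab d"
    by blast
  have "lab d \<in> labs b" "n \<in> labs b" "sub n b = Some b"
    using assms(3) labs_alts[OF assms(4)] lab_in_labs[of d] by (auto simp: labs_def)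
  with d' annotation_step(1)[OF assms(1), of n b s d' s] s assms(2) show "s \<in> an (lab d)"
    by (auto simp: okf_def)
qed

text \<open>Control leaves an alternative of a conditional towards the exit of the conditional, but
  a loop body towards the label of the loop. In both cases the exit \<open>h\<close> lies outside
  \<open>labs d\<close>: by \<open>okf b f\<close>, \<open>f\<close> is no label of \<open>b\<close>
  and \<open>n\<close> does not recur inside \<open>g\<close>.\<close>

lemma annotation_alternative:
  assumes "valid_annotation (aut I b f) an" and "okf b f"
    and "b = IfFi n g \<and> h = f \<or> b = DoOd n g \<and> h = n" and "(e, d) \<in> alts g"
  shows "okf d h \<and> valid_annotation (aut I d h) an"
proof -
  have ok: "okf d h"
    using assms(2,3) labs_alts[OF assms(4)] distinct_alts[OF assms(4)]
    by (auto simp: okf_def labs_def)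
  have "sub m b = sub m d \<and> fsuc m b f = fsuc m d h" if "m \<in> labs d" for m
    using sub_fsuc_alts[OF assms(4) _ that, of h] that assms(2,3) labs_alts[OF assms(4)]
    by (auto simp: okf_def labs_def)
  moreover have "labs d \<union> {h} \<subseteq> labs b \<union> {f}"
    using assms(3) labs_alts[OF assms(4)] by (auto simp: labs_def)
  ultimately show ?thesis
    using valid_annotation_subcommand[OF assms(1)] ok by (auto simp: okf_def)
qed

text \<open>Only \<open>b\<close> and its exit \<open>h\<close> vary in the induction; the set of
  assertions stays that of the enclosing command \<open>c\<close>, so that the derivations for
  components can be combined. The second part hands the induction hypothesis to every alternative of
  a guarded command list.\<close>

lemma HLplus_annotation:
  fixes b :: "('f, 'p) com" and g :: "('f, 'p) gcs"
  shows "\<lbrakk>okf b h; valid_annotation (aut I b h) an; labs b \<union> {h} \<subseteq> ctrl (aut I c f);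
      bexps b \<subseteq> bexps c; assigns b \<subseteq> assigns c\<rbrakk>
    \<Longrightarrow> HLplus I (assertions_from I c f an pc) b (an (lab b)) (an h)"
    and "\<lbrakk>(e, d) \<in> alts g; okf d h; valid_annotation (aut I d h) an;
      labs d \<union> {h} \<subseteq> ctrl (aut I c f); bexps d \<subseteq> bexps c; assigns d \<subseteq> assigns c\<rbrakk>
    \<Longrightarrow> HLplus I (assertions_from I c f an pc) d (an (lab d)) (an h)"
proof (induction b and g arbitrary: h and e d h)
  case (Skip n)
  have "an n \<subseteq> an h"
    using Skip.prems(2)[unfolded valid_annotation_def, rule_format, of n h]
    by (auto simp: aut_def labs_def)
  moreover have "an n \<in> assertions_from I c f an pc" "an h \<in> assertions_from I c f an pc"
    using Skip.prems(3) by (auto intro!: assertions_from.annot simp: labs_def)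
  ultimately show ?case
    using HLplus.Conseq[OF _ HLplus.Skip subset_refl] by auto
next
  case (Assign n x a)
  \<comment> \<open>Positivity gives the residual \<open>Skip (- n)\<close> a negative label, so
    that the assignment counts as terminated and control reaches \<open>h\<close>.\<close>
  have "0 < n"
    using Assign.prems(1) by (auto simp: okf_def labs_def)
  have "an n \<subseteq> asubst I x a (an h)"
  proof
    fix s assume "s \<in> an n"
    then show "s \<in> asubst I x a (an h)"
      using annotation_step(2)[OF Assign.prems(2) _ _ _ step.intros(4)[of I n x a s]] \<open>0 < n\<close>
      by (simp add: asubst_def labs_def)
  qed
  moreover have "an n \<in> assertions_from I c f an pc" "an h \<in> assertions_from I c f an pc"
    "asubst I x a (an h) \<in> assertions_from I c f an pc"
    using Assign.prems(3,5) by (auto intro!: assertions_from.annot assertions_from.subst simp: labs_def)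
  ultimately show ?case
    using HLplus.Conseq[OF _ HLplus.Asgn subset_refl] by auto
next
  case (Seq b d)
  have dist: "distinct (lablist b @ lablist d)"
    using Seq.prems(1) by (simp add: okf_def)
  \<comment> \<open>The exit of the first component is the entry of the second;
    \<open>an (lab d)\<close> becomes the intermediate assertion.\<close>
  have okb: "okf b (lab d)" and okd: "okf d h"
    using Seq.prems(1) lab_in_labs[of d] by (auto simp: okf_def labs_def)
  have "valid_annotation (aut I b (lab d)) an"
    using valid_annotation_subcommand[OF Seq.prems(2), of b "lab d"] okb lab_in_labs[of d]
    by (auto simp: okf_def labs_def)
  moreover have "valid_annotation (aut I d h) an"
  proof (rule valid_annotation_subcommand[OF Seq.prems(2)])
    show "sub n (Seq b d) = sub n d \<and> fsuc n (Seq b d) h = fsuc n d h" if "n \<in> labs d" for n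
      using that dist by (auto simp: labs_def)
  qed (use okd in \<open>auto simp: okf_def labs_def\<close>)
  moreover have "labs b \<union> {lab d} \<subseteq> ctrl (aut I c f)" "labs d \<union> {h} \<subseteq> ctrl (aut I c f)"
    using Seq.prems(3) lab_in_labs[of d] by (auto simp: labs_def)
  ultimately have
    "HLplus I (assertions_from I c f an pc) b (an (lab b)) (an (lab d))"
    "HLplus I (assertions_from I c f an pc) d (an (lab d)) (an h)"
    using Seq.IH(1)[OF okb] Seq.IH(2)[OF okd] Seq.prems(4,5) by auto
  then show ?case
    by (auto intro: HLplus.Seq)
next
  case (IfFi n g)
  let ?A = "assertions_from I c f an pc"
  have A: "an n \<in> ?A" "an h \<in> ?A"
    using IfFi.prems(3) by (auto intro!: assertions_from.annot simp: labs_def)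
  have "HLplus I ?A d (bsem I e \<inter> an n) (an h)" if d: "(e, d) \<in> alts g" for e d
  proof (rule HLplus.Conseq)
    show "bsem I e \<inter> an n \<subseteq> an (lab d)"
      by (rule annotation_branch[OF IfFi.prems(2,1) _ d]) simp
    show "HLplus I ?A d (an (lab d)) (an h)"
      using annotation_alternative[OF IfFi.prems(2,1) _ d, of n h] IfFi.prems(3-5)
        labs_alts[OF d] bexps_alts[OF d] assigns_alts[OF d]
      by (intro IfFi.IH[OF d]) (auto simp: labs_def)
    show "bsem I e \<inter> an n \<in> ?A"
      using A guard_in_bexps[OF d] IfFi.prems(4)
      by (auto intro!: assertions_from.conj assertions_from.bool)
  qed (simp_all add: A)
  then show ?case
    using A by (auto intro: HLplus.If)
next
  case (DoOd n g)
  let ?A = "assertions_from I c f an pc"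
  have A: "an n \<in> ?A" "an h \<in> ?A"
    using DoOd.prems(3) by (auto intro!: assertions_from.annot simp: labs_def)
  have enab: "bsem I (enab g) \<in> ?A"
    using DoOd.prems(4) by (simp add: enab_in_assertions_from)
  \<comment> \<open>The body has exit \<open>n\<close>, so its derivation ends in the invariant
    \<open>an n\<close>.\<close>
  have "HLplus I ?A d (bsem I e \<inter> an n) (an n)" if d: "(e, d) \<in> alts g" for e d
  proof (rule HLplus.Conseq)
    show "bsem I e \<inter> an n \<subseteq> an (lab d)"
      by (rule annotation_branch[OF DoOd.prems(2,1) _ d]) simp
    show "HLplus I ?A d (an (lab d)) (an n)"
      using annotation_alternative[OF DoOd.prems(2,1) _ d, of n n] DoOd.prems(3-5)
        labs_alts[OF d] bexps_alts[OF d] assigns_alts[OF d]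
      by (intro DoOd.IH[OF d]) (auto simp: labs_def)
    show "bsem I e \<inter> an n \<in> ?A"
      using A guard_in_bexps[OF d] DoOd.prems(4)
      by (auto intro!: assertions_from.conj assertions_from.bool)
  qed (simp_all add: A)
  then have loop: "HLplus I ?A (DoOd n g) (an n) (an n \<inter> - bsem I (enab g))"
    by (rule HLplus.Do) (auto intro: A enab assertions_from.conj assertions_from.neg)
  have "0 < n"
    using DoOd.prems(1) by (auto simp: okf_def labs_def)
  \<comment> \<open>With all guards false the loop steps to \<open>Skip (- n)\<close>, whose
    negative label sends control to \<open>h\<close>.\<close>
  have "an n \<inter> - bsem I (enab g) \<subseteq> an h"
  proof
    fix s assume "s \<in> an n \<inter> - bsem I (enab g)"
    then show "s \<in> an h"
      using annotation_step(2)[where n = n, OF DoOd.prems(2) _ _ _ step.intros(3)[of I g s n]] \<open>0 < n\<close>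
      by (simp add: bsem_def labs_def)
  qed
  then show ?case
    using HLplus.Conseq[OF subset_refl loop _ A] by simp
next
  case (GC e' b)
  then show ?case by auto
next
  case (GCs e' b g)
  then show ?case by auto
qed

theorem theorem6p1:
  fixes I :: "('f, 'p) interp"
    and c :: "('f, 'p) com"
    and f :: int
    and P Q :: assertion
    and an :: "int \<Rightarrow> assertion"
    and pc :: vname
  assumes "wellformed I c"
    and "okf c f"
    and "annotation_for (aut I c f) P Q an"
    and "valid_annotation (aut I c f) an"
    and "pc \<notin> vars c"
  shows "HLplus I (assertions_from I c f an pc) c P Q"
proof -
  have "P = an (lab c)" "Q = an f"
    using assms(3) by (auto simp: annotation_for_def aut_def)
  then show ?thesis
    using HLplus_annotation(1)[OF assms(2,4), of c f pc] by (simp add: aut_def)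
qed

end
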